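(* $(\mathcal{P},\succ,\prec)$ is the free $\mathcal{L}$-algebra generated by $\bullet$. That is, it is an $\mathcal{L}$-algebra, and for every $\mathcal{L}$-algebra $A$ and every $a\in A$ there is a unique morphism of $\mathcal{L}$-algebras $\phi:\mathcal{P}\to A$ with $\phi(\bullet)=a$.
   Context: $\mathbb{K}$ is a commutative field of any characteristic. An $\mathcal{L}$-algebra is a $\mathbb{K}$-vector space with two bilinear operations $\succ,\prec$ satisfying $(x\succ y)\prec z=x\succ(y\prec z)$ for all $x,y,z$; morphisms are linear maps preserving both operations (no units assumed). We consider planar rooted forests (finite ordered sequences of planar rooted trees) whose edges are decorated by $l$ or $r$; $1$ is the empty forest and $\bullet$ the tree with one vertex. For two such forests $F,G$, $B(F\otimes G)$ is the tree obtained by grafting the roots of the trees of $F$ followed by those of $G$ (in this left-to-right order) on a common new root, the edges from the new root to the roots of $F$ being decorated by $l$ and those to the roots of $G$ by $r$. Let $\mathbb{T}$ be the set consisting of $1$ and of the trees obtained inductively as $B(F_1\cdots F_p\otimes G_1\cdots G_q)$, $p,q\ge 0$, with all $F_i,G_j$ nonempty trees already in $\mathbb{T}$. $\mathcal{P}=\mathbb{K}[\mathbb{T}\setminus\{1\}]$ is the vector space with basis the nonempty trees of $\mathbb{T}$, with the operations given, for nonempty trees $F=B(F^1\otimes F^2)$ and $G=B(G^1\otimes G^2)$ in $\mathbb{T}$ ($F^i,G^i$ forests of trees of $\mathbb{T}$), by $G\succ F=B(GF^1\otimes F^2)$ and $G\prec F=B(G^1\otimes G^2F)$, extended bilinearly.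 ($\mathcal{P}$ is the space of primitive elements of the reduced deconcatenation coproduct on the space spanned by nonempty forests of trees of $\mathbb{T}$.) *)

theory Defs
  imports Complex_Main "HOL-Library.Poly_Mapping"
begin

locale L_algebra = vector_space scale
  for scale :: "'k::field \<Rightarrow> 'a::ab_group_add \<Rightarrow> 'a" +
  fixes succ :: "'a \<Rightarrow> 'a \<Rightarrow> 'a" and prec :: "'a \<Rightarrow> 'a \<Rightarrow> 'a"
  assumes linear_succ_left: "Vector_Spaces.linear scale scale (\<lambda>x. succ x y)"
    and linear_succ_right: "Vector_Spaces.linear scale scale (\<lambda>y. succ x y)"
    and linear_prec_left: "Vector_Spaces.linear scale scale (\<lambda>x. prec x y)"
    and linear_prec_right: "Vector_Spaces.linear scale scale (\<lambda>y. prec x y)"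
    and succ_prec_assoc: "prec (succ x y) z = succ x (prec y z)"

definition L_algebra_hom ::
  "('k::field \<Rightarrow> 'a::ab_group_add \<Rightarrow> 'a) \<Rightarrow> ('a \<Rightarrow> 'a \<Rightarrow> 'a) \<Rightarrow> ('a \<Rightarrow> 'a \<Rightarrow> 'a) \<Rightarrow>
   ('k \<Rightarrow> 'b::ab_group_add \<Rightarrow> 'b) \<Rightarrow> ('b \<Rightarrow> 'b \<Rightarrow> 'b) \<Rightarrow> ('b \<Rightarrow> 'b \<Rightarrow> 'b) \<Rightarrow>
   ('a \<Rightarrow> 'b) \<Rightarrow> bool" where
  "L_algebra_hom scale\<^sub>1 succ\<^sub>1 prec\<^sub>1 scale\<^sub>2 succ\<^sub>2 prec\<^sub>2 \<phi> \<longleftrightarrow>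
     Vector_Spaces.linear scale\<^sub>1 scale\<^sub>2 \<phi> \<and>
     (\<forall>x y. \<phi> (succ\<^sub>1 x y) = succ\<^sub>2 (\<phi> x) (\<phi> y)) \<and>
     (\<forall>x y. \<phi> (prec\<^sub>1 x y) = prec\<^sub>2 (\<phi> x) (\<phi> y))"


datatype edge = L_edge | R_edge

text \<open>A vertex carries the ordered list of its children, each with the decoration of the edge
  leading to it. A forest is a list of trees, and the forest 1 is the empty list.\<close>

datatype dtree = Node (children: "(edge \<times> dtree) list")

type_synonym forest = "dtree list"

definition B :: "forest \<Rightarrow> forest \<Rightarrow> dtree" where
  "B F G = Node (map (Pair L_edge) F @ map (Pair R_edge) G)"

definition left_part :: "dtree \<Rightarrow> forest" where
  "left_part t = map snd (filter (\<lambda>c. fst c = L_edge) (children t))"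

definition right_part :: "dtree \<Rightarrow> forest" where
  "right_part t = map snd (filter (\<lambda>c. fst c = R_edge) (children t))"

lemma left_part_B [simp]: "left_part (B F G) = F"
  by (simp add: left_part_def B_def filter_map o_def)

lemma right_part_B [simp]: "right_part (B F G) = G"
  by (simp add: right_part_def B_def filter_map o_def)

text \<open>The set T consists of forests of length at most one: 1 and the one-tree forests.\<close>

inductive_set TT :: "forest set" where
  one: "[] \<in> TT"
| graft: "\<forall>t \<in> set F \<union> set G. [t] \<in> TT \<Longrightarrow> [B F G] \<in> TT"

text \<open>The elements of T other than 1, as a type.\<close>

typedef ltree = "{t. [t] \<in> TT}"
proof
  show "B [] [] \<in> {t. [t] \<in> TT}"
    using TT.graft[of "[]" "[]"] by simp
qed

lemma TT_treeE:
  assumes "[t] \<in> TT"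
  obtains F G where "t = B F G" "\<forall>s \<in> set F \<union> set G. [s] \<in> TT"
  using assms by (cases rule: TT.cases) auto

lemma B_parts: "[t] \<in> TT \<Longrightarrow> B (left_part t) (right_part t) = t"
  by (erule TT_treeE) simp

definition bullet_tree :: ltree where
  "bullet_tree = Abs_ltree (B [] [])"

text \<open>Both operations are named in the order of their arguments: \<open>tree_succ G F\<close> grafts \<open>G\<close> as
  leftmost child on the root of \<open>F\<close>, and \<open>tree_prec G F\<close> grafts \<open>F\<close> as rightmost child on the
  root of \<open>G\<close>.\<close>

definition tree_succ :: "ltree \<Rightarrow> ltree \<Rightarrow> ltree" where
  "tree_succ G F =
     Abs_ltree (B (Rep_ltree G # left_part (Rep_ltree F)) (right_part (Rep_ltree F)))"

definition tree_prec :: "ltree \<Rightarrow> ltree \<Rightarrow> ltree" where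
  "tree_prec G F =
     Abs_ltree (B (left_part (Rep_ltree G)) (right_part (Rep_ltree G) @ [Rep_ltree F]))"

lemma Rep_bullet_tree: "Rep_ltree bullet_tree = B [] []"
  using TT.graft[of "[]" "[]"] by (simp add: bullet_tree_def Abs_ltree_inverse)

lemma Rep_tree_succ:
  assumes "Rep_ltree F = B F1 F2"
  shows "Rep_ltree (tree_succ G F) = B (Rep_ltree G # F1) F2"
proof -
  have F: "[B F1 F2] \<in> TT" and G: "[Rep_ltree G] \<in> TT"
    using Rep_ltree[of F] Rep_ltree[of G] assms by auto
  from F have "\<forall>t \<in> set F1 \<union> set F2. [t] \<in> TT"
    by (rule TT_treeE) (metis left_part_B right_part_B)
  with G have "[B (Rep_ltree G # F1) F2] \<in> TT"
    by (intro TT.graft) auto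
  with assms show ?thesis
    by (simp add: tree_succ_def Abs_ltree_inverse)
qed

lemma Rep_tree_prec:
  assumes "Rep_ltree G = B G1 G2"
  shows "Rep_ltree (tree_prec G F) = B G1 (G2 @ [Rep_ltree F])"
proof -
  have G: "[B G1 G2] \<in> TT" and F: "[Rep_ltree F] \<in> TT"
    using Rep_ltree[of G] Rep_ltree[of F] assms by auto
  from G have "\<forall>t \<in> set G1 \<union> set G2. [t] \<in> TT"
    by (rule TT_treeE) (metis left_part_B right_part_B)
  with F have "[B G1 (G2 @ [Rep_ltree F])] \<in> TT"
    by (intro TT.graft) auto
  with assms show ?thesis
    by (simp add: tree_prec_def Abs_ltree_inverse)
qed


type_synonym 'k P = "ltree \<Rightarrow>\<^sub>0 'k"

definition P_scale :: "'k::field \<Rightarrow> 'k P \<Rightarrow> 'k P" where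
  "P_scale c p = Poly_Mapping.map (\<lambda>x. c * x) p"

definition bilinear_extension ::
  "(ltree \<Rightarrow> ltree \<Rightarrow> ltree) \<Rightarrow> 'k::field P \<Rightarrow> 'k P \<Rightarrow> 'k P" where
  "bilinear_extension f p q =
     (\<Sum>s \<in> Poly_Mapping.keys p. \<Sum>t \<in> Poly_Mapping.keys q.
        Poly_Mapping.single (f s t) (Poly_Mapping.lookup p s * Poly_Mapping.lookup q t))"

definition P_succ :: "'k::field P \<Rightarrow> 'k P \<Rightarrow> 'k P" where
  "P_succ = bilinear_extension tree_succ"

definition P_prec :: "'k::field P \<Rightarrow> 'k P \<Rightarrow> 'k P" where
  "P_prec = bilinear_extension tree_prec"

definition P_bullet :: "'k::field P" where
  "P_bullet = Poly_Mapping.single bullet_tree 1"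

lemma P_succ_single:
  "P_succ (Poly_Mapping.single s 1) (Poly_Mapping.single t 1) =
     (Poly_Mapping.single (tree_succ s t) 1 :: 'k::field P)"
  by (simp add: P_succ_def bilinear_extension_def)

lemma P_prec_single:
  "P_prec (Poly_Mapping.single s 1) (Poly_Mapping.single t 1) =
     (Poly_Mapping.single (tree_prec s t) 1 :: 'k::field P)"
  by (simp add: P_prec_def bilinear_extension_def)

end

theory Submission
  imports Defs
begin

text \<open>The two grafting operations build every tree from the single vertex, because the tree
  \<open>B (F\<^sub>1\<dots>F\<^sub>p) (G\<^sub>1\<dots>G\<^sub>q)\<close> equals
  \<open>F\<^sub>1 \<succ> (\<dots> \<succ> (F\<^sub>p \<succ> ((\<bullet> \<prec> G\<^sub>1) \<prec> \<dots> \<prec> G\<^sub>q)))\<close>. A morphism on \<open>\<P>\<close> is therefore determined by its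
  value at \<open>\<bullet>\<close> (\<open>ltree_induct\<close>).

  Conversely, this normal form dictates how to evaluate a tree in an algebra with a chosen
  element \<open>a\<close>: evaluate the subtrees, put \<open>a\<close> in the place of the root and act on it by
  \<open>\<succ>\<close> from the left and by \<open>\<prec>\<close> from the right. The evaluation below performs all left actions
  first, so that it respects \<open>\<prec>\<close> by its very shape. For \<open>G \<succ> F\<close> the new left action has
  to be moved past all right actions, which is exactly what the axiom
  \<open>(x \<succ> y) \<prec> z = x \<succ> (y \<prec> z)\<close> allows (\<open>succ_foldl_prec\<close>). The linear extension of the evaluation
  is the required morphism.

  All identities between elements of \<open>\<P>\<close> are multilinear, so they are checked on trees only
  (\<open>linear_eq_on_trees\<close>). On trees, the axiom holds in \<open>\<P>\<close> because grafting on the left and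
  grafting on the right of a root do not interfere.\<close>

section \<open>Trees\<close>

lemma Rep_ltree_B: "\<exists>F G. Rep_ltree t = B F G"
  by (metis B_parts Rep_ltree mem_Collect_eq)

lemma tree_succ_prec_assoc:
  "tree_prec (tree_succ x y) z = tree_succ x (tree_prec y z)"
proof -
  obtain F G where y: "Rep_ltree y = B F G"
    using Rep_ltree_B by blast
  have "Rep_ltree (tree_prec (tree_succ x y) z) = B (Rep_ltree x # F) (G @ [Rep_ltree z])"
    by (rule Rep_tree_prec) (rule Rep_tree_succ[OF y])
  also have "\<dots> = Rep_ltree (tree_succ x (tree_prec y z))"
    by (rule Rep_tree_succ[symmetric]) (rule Rep_tree_prec[OF y])
  finally show ?thesis
    by (simp add: Rep_ltree_inject)
qed

text \<open>The right children of a root are grafted one after the other on a single vertex, and then the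
  left children, starting with the one next to the right children.\<close>

lemma ltree_induct [case_names bullet succ prec]:
  assumes bullet: "Q bullet_tree"
    and succ: "\<And>s t. Q s \<Longrightarrow> Q t \<Longrightarrow> Q (tree_succ s t)"
    and prec: "\<And>s t. Q s \<Longrightarrow> Q t \<Longrightarrow> Q (tree_prec s t)"
  shows "Q t"
proof -
  define R where "R u \<longleftrightarrow> (\<exists>t. Rep_ltree t = u \<and> Q t)" for u
  have right: "R (B [] G)" if "\<forall>u \<in> set G. R u" for G
    using that
  proof (induction G rule: rev_induct)
    case Nil
    show ?case using bullet Rep_bullet_tree by (auto simp: R_def)
  next
    case (snoc u G)
    then obtain s t where "Rep_ltree s = B [] G" "Q s" "Rep_ltree t = u" "Q t"
      by (auto simp: R_def)
    then show ?case
      unfolding R_def using Rep_tree_prec[of s "[]" G t] prec by blast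
  qed
  have left: "R (B F G)" if "\<forall>u \<in> set F. R u" "R (B [] G)" for F G
    using that
  proof (induction F)
    case Nil
    then show ?case by simp
  next
    case (Cons u F)
    then obtain s t where "Rep_ltree t = B F G" "Q t" "Rep_ltree s = u" "Q s"
      by (auto simp: R_def)
    then show ?case
      unfolding R_def using Rep_tree_succ[of t F G s] succ by blast
  qed
  have "\<forall>u \<in> set x. R u" if "x \<in> TT" for x
    using that
  proof (induction rule: TT.induct)
    case one
    show ?case by simp
  next
    case (graft F G)
    then show ?case using left[of F G] right[of G] by simp
  qed
  then have "R (Rep_ltree t)"
    using Rep_ltree[of t] by force
  then show ?thesis
    by (auto simp: R_def Rep_ltree_inject)
qed


section \<open>Linear maps on the span of the trees\<close>

definition linear_extension ::
  "('k::field \<Rightarrow> 'a::ab_group_add \<Rightarrow> 'a) \<Rightarrow> (ltree \<Rightarrow> 'a) \<Rightarrow> 'k P \<Rightarrow> 'a" where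
  "linear_extension scale h p =
     (\<Sum>t \<in> Poly_Mapping.keys p. scale (Poly_Mapping.lookup p t) (h t))"

lemma lookup_P_scale [simp]:
  "Poly_Mapping.lookup (P_scale c p) t = c * Poly_Mapping.lookup p t"
  by (simp add: P_scale_def Poly_Mapping.map.rep_eq when_def)

lemma vector_space_P: "vector_space (P_scale :: 'k::field \<Rightarrow> 'k P \<Rightarrow> 'k P)"
  by unfold_locales (auto intro!: poly_mapping_eqI simp: lookup_add algebra_simps)

context vector_space
begin

lemma linear_extension_superset:
  assumes "finite S" "Poly_Mapping.keys p \<subseteq> S"
  shows "linear_extension scale h p = (\<Sum>t \<in> S. scale (Poly_Mapping.lookup p t) (h t))"
  unfolding linear_extension_def
  by (rule sum.mono_neutral_left) (use assms in \<open>auto simp: in_keys_iff\<close>)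

lemma linear_linear_extension: "Vector_Spaces.linear P_scale scale (linear_extension scale h)"
  unfolding Vector_Spaces.linear_iff
proof (intro conjI allI)
  show "vector_space (P_scale :: 'a \<Rightarrow> 'a P \<Rightarrow> 'a P)" by (rule vector_space_P)
  show "vector_space scale" by unfold_locales
next
  fix p q :: "'a P"
  let ?S = "Poly_Mapping.keys p \<union> Poly_Mapping.keys q"
  have "linear_extension scale h (p + q) =
      (\<Sum>t \<in> ?S. scale (Poly_Mapping.lookup (p + q) t) (h t))"
    by (rule linear_extension_superset) (auto simp: Poly_Mapping.keys_add)
  also have "\<dots> = (\<Sum>t \<in> ?S. scale (Poly_Mapping.lookup p t) (h t)) +
      (\<Sum>t \<in> ?S. scale (Poly_Mapping.lookup q t) (h t))"
    by (simp add: lookup_add scale_left_distrib sum.distrib)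
  finally show "linear_extension scale h (p + q) =
      linear_extension scale h p + linear_extension scale h q"
    using linear_extension_superset[of ?S p h] linear_extension_superset[of ?S q h] by simp
next
  fix c and p :: "'a P"
  have "linear_extension scale h (P_scale c p) =
      (\<Sum>t \<in> Poly_Mapping.keys p. scale (Poly_Mapping.lookup (P_scale c p) t) (h t))"
    by (rule linear_extension_superset) (auto simp: in_keys_iff)
  then show "linear_extension scale h (P_scale c p) = scale c (linear_extension scale h p)"
    by (simp add: linear_extension_def scale_sum_right)
qed

lemma linear_extension_single [simp]:
  "linear_extension scale h (Poly_Mapping.single t 1) = h t"
  by (simp add: linear_extension_def)

end

lemma linear_extension_singles:
  fixes p :: "'k::field P"
  shows "linear_extension P_scale (\<lambda>t. Poly_Mapping.single t 1) p = p"
proof (rule poly_mapping_eqI)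
  fix u
  have "Poly_Mapping.lookup (linear_extension P_scale (\<lambda>t. Poly_Mapping.single t 1) p) u =
      (\<Sum>t \<in> Poly_Mapping.keys p. if t = u then Poly_Mapping.lookup p t else 0)"
    by (simp add: linear_extension_def lookup_sum lookup_single when_def
        if_distrib cong: if_cong)
  then show "Poly_Mapping.lookup (linear_extension P_scale (\<lambda>t. Poly_Mapping.single t 1) p) u =
      Poly_Mapping.lookup p u"
    by (simp add: in_keys_iff)
qed

lemma linear_eq_on_trees:
  fixes f g :: "'k::field P \<Rightarrow> 'a::ab_group_add"
  assumes f: "Vector_Spaces.linear P_scale scale f" and g: "Vector_Spaces.linear P_scale scale g"
    and eq: "\<And>t. f (Poly_Mapping.single t 1) = g (Poly_Mapping.single t 1)"
  shows "f p = g p"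
proof -
  have *: "h p = linear_extension scale (\<lambda>t. h (Poly_Mapping.single t 1)) p"
    if "Vector_Spaces.linear P_scale scale h" for h
  proof -
    interpret h: Vector_Spaces.linear P_scale scale h by fact
    have "h p = h (linear_extension P_scale (\<lambda>t. Poly_Mapping.single t 1) p)"
      by (simp only: linear_extension_singles)
    then show ?thesis
      by (simp add: linear_extension_def h.sum h.scale)
  qed
  show ?thesis
    using *[OF f] *[OF g] eq by simp
qed

text \<open>As an iterated linear extension, the bilinear extension inherits linearity in the first
  argument. Linearity in the second one follows by exchanging the arguments.\<close>

lemma bilinear_extension_eq:
  "bilinear_extension f p q =
     linear_extension P_scale
       (\<lambda>s. linear_extension P_scale (\<lambda>t. Poly_Mapping.single (f s t) 1) q) p"
proof -
  interpret vector_space P_scale by (rule vector_space_P)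
  have single: "Poly_Mapping.single u c = P_scale c (Poly_Mapping.single u 1)" for u and c :: 'a
    by (rule poly_mapping_eqI) (simp add: lookup_single when_def)
  show ?thesis
    unfolding bilinear_extension_def linear_extension_def
    by (subst single) (simp add: scale_sum_right)
qed

lemma linear_bilinear_extension_left:
  "Vector_Spaces.linear P_scale P_scale (\<lambda>p. bilinear_extension f p q)"
  unfolding bilinear_extension_eq
  by (rule vector_space.linear_linear_extension[OF vector_space_P])

lemma bilinear_extension_swap:
  "bilinear_extension f p q = bilinear_extension (\<lambda>s t. f t s) q p"
  unfolding bilinear_extension_def by (subst sum.swap) (simp add: mult.commute)

lemma linear_bilinear_extension_right:
  "Vector_Spaces.linear P_scale P_scale (\<lambda>q. bilinear_extension f p q)"
  by (subst bilinear_extension_swap) (rule linear_bilinear_extension_left)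

lemma bilinear_extension_single:
  "bilinear_extension f (Poly_Mapping.single s 1) (Poly_Mapping.single t 1) =
     (Poly_Mapping.single (f s t) 1 :: 'k::field P)"
  by (simp add: bilinear_extension_def)

lemma linear_comp:
  assumes "Vector_Spaces.linear s1 s2 f" "Vector_Spaces.linear s2 s3 g"
  shows "Vector_Spaces.linear s1 s3 (\<lambda>x. g (f x))"
  using Vector_Spaces.linear_compose[OF assms] by (simp add: o_def)

text \<open>When the second argument is fixed, both sides are linear in the first one, which may
  therefore be taken to be a tree. The second argument is then treated in the same way.\<close>

lemma linear_map_bilinear_extension:
  fixes \<phi> :: "'k::field P \<Rightarrow> 'a::ab_group_add"
  assumes \<phi>: "Vector_Spaces.linear P_scale scale \<phi>"
    and left: "\<And>y. Vector_Spaces.linear scale scale (\<lambda>x. m x y)"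
    and right: "\<And>x. Vector_Spaces.linear scale scale (\<lambda>y. m x y)"
    and trees: "\<And>s t. \<phi> (Poly_Mapping.single (f s t) 1) =
      m (\<phi> (Poly_Mapping.single s 1)) (\<phi> (Poly_Mapping.single t 1))"
  shows "\<phi> (bilinear_extension f p q) = m (\<phi> p) (\<phi> q)"
proof (rule linear_eq_on_trees[where f = "\<lambda>p. \<phi> (bilinear_extension f p q)"])
  show "Vector_Spaces.linear P_scale scale (\<lambda>p. \<phi> (bilinear_extension f p q))"
    by (rule linear_comp[OF linear_bilinear_extension_left \<phi>])
  show "Vector_Spaces.linear P_scale scale (\<lambda>p. m (\<phi> p) (\<phi> q))"
    by (rule linear_comp[OF \<phi> left])
  show "\<phi> (bilinear_extension f (Poly_Mapping.single s 1) q) =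
      m (\<phi> (Poly_Mapping.single s 1)) (\<phi> q)" for s
  proof (rule linear_eq_on_trees
      [where f = "\<lambda>q. \<phi> (bilinear_extension f (Poly_Mapping.single s 1) q)"])
    show "Vector_Spaces.linear P_scale scale
        (\<lambda>q. \<phi> (bilinear_extension f (Poly_Mapping.single s 1) q))"
      by (rule linear_comp[OF linear_bilinear_extension_right \<phi>])
    show "Vector_Spaces.linear P_scale scale (\<lambda>q. m (\<phi> (Poly_Mapping.single s 1)) (\<phi> q))"
      by (rule linear_comp[OF \<phi> right])
  qed (simp add: bilinear_extension_single trees)
qed


section \<open>The algebra of trees\<close>

lemma L_algebra_P: "L_algebra (P_scale :: 'k::field \<Rightarrow> 'k P \<Rightarrow> 'k P) P_succ P_prec"
proof -
  note left = linear_bilinear_extension_left and right = linear_bilinear_extension_right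
  have assoc: "P_prec (P_succ x y) z = P_succ x (P_prec y z)" for x y z :: "'k P"
    unfolding P_prec_def P_succ_def
  proof (rule linear_eq_on_trees[OF linear_comp[OF left left] left])
    fix s
    let ?x = "Poly_Mapping.single s 1 :: 'k P"
    show "bilinear_extension tree_prec (bilinear_extension tree_succ ?x y) z =
        bilinear_extension tree_succ ?x (bilinear_extension tree_prec y z)"
    proof (rule linear_eq_on_trees[OF linear_comp[OF right left] linear_comp[OF left right]])
      fix t
      let ?y = "Poly_Mapping.single t 1 :: 'k P"
      show "bilinear_extension tree_prec (bilinear_extension tree_succ ?x ?y) z =
          bilinear_extension tree_succ ?x (bilinear_extension tree_prec ?y z)"
        by (rule linear_eq_on_trees[OF right linear_comp[OF right right]])
          (simp add: bilinear_extension_single tree_succ_prec_assoc)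
    qed
  qed
  show ?thesis
    unfolding L_algebra_def L_algebra_axioms_def
    using vector_space_P assoc by (auto simp: P_succ_def P_prec_def left right)
qed


section \<open>Evaluation of trees in an algebra\<close>

context L_algebra
begin

definition act :: "'a \<Rightarrow> 'a list \<Rightarrow> 'a list \<Rightarrow> 'a" where
  "act a xs ys = foldl prec (foldr succ xs a) ys"

text \<open>The subtrees are evaluated in place, before the two decorations are separated, to keep the
  recursion structural on the list of children.\<close>

primrec eval_tree :: "'a \<Rightarrow> dtree \<Rightarrow> 'a" where
  "eval_tree a (Node cs) =
     (let ds = map (map_prod id (eval_tree a)) cs
      in act a (map snd (filter (\<lambda>d. fst d = L_edge) ds))
           (map snd (filter (\<lambda>d. fst d = R_edge) ds)))"

lemma eval_tree_B: "eval_tree a (B F G) = act a (map (eval_tree a) F) (map (eval_tree a) G)"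
  by (simp add: B_def filter_map o_def)

text \<open>The axiom of \<open>\<L>\<close>-algebras moves one left action past one right action; it is applied here to
  all the right actions of a root in turn.\<close>

lemma succ_foldl_prec: "foldl prec (succ x y) zs = succ x (foldl prec y zs)"
  by (induction zs arbitrary: y) (simp_all add: succ_prec_assoc)

lemma eval_tree_succ:
  "eval_tree a (Rep_ltree (tree_succ s t)) =
     succ (eval_tree a (Rep_ltree s)) (eval_tree a (Rep_ltree t))"
proof -
  obtain F G where t: "Rep_ltree t = B F G"
    using Rep_ltree_B by blast
  show ?thesis
    by (simp add: Rep_tree_succ[OF t] t eval_tree_B act_def succ_foldl_prec)
qed

lemma eval_tree_prec:
  "eval_tree a (Rep_ltree (tree_prec s t)) =
     prec (eval_tree a (Rep_ltree s)) (eval_tree a (Rep_ltree t))"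
proof -
  obtain F G where s: "Rep_ltree s = B F G"
    using Rep_ltree_B by blast
  show ?thesis
    by (simp add: Rep_tree_prec[OF s] s eval_tree_B act_def)
qed

lemma ex_hom_P:
  "\<exists>\<phi>. L_algebra_hom P_scale P_succ P_prec scale succ prec \<phi> \<and> \<phi> P_bullet = a"
proof (intro exI conjI)
  let ?\<phi> = "linear_extension scale (\<lambda>t. eval_tree a (Rep_ltree t))"
  show "L_algebra_hom P_scale P_succ P_prec scale succ prec ?\<phi>"
    unfolding L_algebra_hom_def P_succ_def P_prec_def
  proof (intro conjI allI)
    show "?\<phi> (bilinear_extension tree_succ p q) = succ (?\<phi> p) (?\<phi> q)" for p q
      by (rule linear_map_bilinear_extension[OF linear_linear_extension
            linear_succ_left linear_succ_right])
        (simp add: eval_tree_succ)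
    show "?\<phi> (bilinear_extension tree_prec p q) = prec (?\<phi> p) (?\<phi> q)" for p q
      by (rule linear_map_bilinear_extension[OF linear_linear_extension
            linear_prec_left linear_prec_right])
        (simp add: eval_tree_prec)
  qed (rule linear_linear_extension)
  show "?\<phi> P_bullet = a"
    by (simp add: P_bullet_def Rep_bullet_tree eval_tree_B act_def)
qed

end

lemma hom_P_unique:
  assumes \<phi>: "L_algebra_hom P_scale P_succ P_prec scale succ prec \<phi>"
    and \<psi>: "L_algebra_hom P_scale P_succ P_prec scale succ prec \<psi>"
    and bullet: "\<phi> P_bullet = \<psi> P_bullet"
  shows "\<phi> = \<psi>"
proof
  fix p
  show "\<phi> p = \<psi> p"
  proof (rule linear_eq_on_trees)
    show "Vector_Spaces.linear P_scale scale \<phi>" "Vector_Spaces.linear P_scale scale \<psi>"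
      using \<phi> \<psi> by (auto simp: L_algebra_hom_def)
    show "\<phi> (Poly_Mapping.single t 1) = \<psi> (Poly_Mapping.single t 1)" for t
    proof (induction t rule: ltree_induct)
      case bullet
      show ?case using assms(3) by (simp add: P_bullet_def)
    next
      case (succ s t)
      then show ?case
        using \<phi> \<psi> by (simp add: L_algebra_hom_def flip: P_succ_single)
    next
      case (prec s t)
      then show ?case
        using \<phi> \<psi> by (simp add: L_algebra_hom_def flip: P_prec_single)
    qed
  qed
qed


section \<open>Freeness\<close>

theorem theorem60:
  shows "L_algebra (P_scale :: 'k::field \<Rightarrow> 'k P \<Rightarrow> 'k P) P_succ P_prec \<and>
    (\<forall>(scale :: 'k \<Rightarrow> 'a::ab_group_add \<Rightarrow> 'a) succ prec a.
       L_algebra scale succ prec \<longrightarrow>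
       (\<exists>!\<phi>. L_algebra_hom P_scale P_succ P_prec scale succ prec \<phi> \<and> \<phi> P_bullet = a))"
proof (intro conjI allI impI)
  show "L_algebra (P_scale :: 'k \<Rightarrow> 'k P \<Rightarrow> 'k P) P_succ P_prec"
    by (rule L_algebra_P)
next
  fix scale :: "'k \<Rightarrow> 'a \<Rightarrow> 'a" and succ prec a
  assume "L_algebra scale succ prec"
  then obtain \<phi> where "L_algebra_hom P_scale P_succ P_prec scale succ prec \<phi>" "\<phi> P_bullet = a"
    using L_algebra.ex_hom_P by blast
  then show "\<exists>!\<phi>. L_algebra_hom P_scale P_succ P_prec scale succ prec \<phi> \<and> \<phi> P_bullet = a"
    by (auto intro: hom_P_unique)
qed

end
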